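(* Let $A,B\in\mathbb{R}^{n\times m}$, let $r=\operatorname{rank}(A)$, and let $k$ be an integer with $1\le k\le\min\{n,m\}$. Then the following hold. (1) If $k>r$, then $C_k(A)=C_k(B)$ if and only if $\operatorname{rank}(B)<k$. (2) If $k=r$ and $A=UV^\top$, with $U\in\mathbb{R}^{n\times r}$ and $V\in\mathbb{R}^{m\times r}$, is a rank-revealing factorization of $A$, then $C_k(A)=C_k(B)$ if and only if $$B\in\{UTV^\top : T\in\mathbb{R}^{r\times r}\text{ with }\det(T)=1\}.$$
   Context: For a matrix $X\in\mathbb{R}^{n\times m}$ and $1\le k\le\min\{n,m\}$, the $k$th multiplicative compound $C_k(X)\in\mathbb{R}^{\binom nk\times\binom mk}$ is the matrix whose $(i,j)$ entry is $\det(X_{I,J})$, where $I$ is the $i$th increasing $k$-tuple of elements of $\{1,\dots,n\}$ and $J$ is the $j$th increasing $k$-tuple of elements of $\{1,\dots,m\}$, both in lexicographic order, and $X_{I,J}$ is the submatrix with rows $I$ and columns $J$. A rank-revealing factorization of a rank-$r$ matrix $A\in\mathbb{R}^{n\times m}$ is a factorization $A=UV^\top$ with $U\in\mathbb{R}^{n\times r}$ and $V\in\mathbb{R}^{m\times r}$ both of full column rank $r$. *)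

theory Defs
  imports
    "Jordan_Normal_Form.DL_Rank"
    "Jordan_Normal_Form.DL_Submatrix"
    "Jordan_Normal_Form.Determinant"
    "HOL-Library.List_Lexorder"
begin

text \<open>
  Indices are 0-based, so tuples range over {0..<n} instead of {1..n}.
  The order on lists used by \<^const>\<open>sorted_list_of_set\<close> is the lexicographic one
  from \<^theory>\<open>HOL-Library.List_Lexorder\<close>.
\<close>

definition increasing_tuple_set :: "nat \<Rightarrow> nat \<Rightarrow> nat list set" where
  "increasing_tuple_set n k = {xs. length xs = k \<and> sorted_wrt (<) xs \<and> set xs \<subseteq> {0..<n}}"

definition increasing_tuples :: "nat \<Rightarrow> nat \<Rightarrow> nat list list" where
  "increasing_tuples n k = sorted_list_of_set (increasing_tuple_set n k)"

lemma bij_betw_increasing_tuple_set: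
  "bij_betw set (increasing_tuple_set n k) {S. S \<subseteq> {0..<n} \<and> card S = k}"
proof (rule bij_betw_byWitness[where f' = sorted_list_of_set])
  show "\<forall>xs \<in> increasing_tuple_set n k. sorted_list_of_set (set xs) = xs"
    by (simp add: increasing_tuple_set_def strict_sorted_iff
        sorted_list_of_set.idem_if_sorted_distinct)
  show "\<forall>S \<in> {S. S \<subseteq> {0..<n} \<and> card S = k}. set (sorted_list_of_set S) = S"
    by (auto dest: finite_subset)
  show "set ` increasing_tuple_set n k \<subseteq> {S. S \<subseteq> {0..<n} \<and> card S = k}"
    by (force simp: increasing_tuple_set_def strict_sorted_iff distinct_card)
  show "sorted_list_of_set ` {S. S \<subseteq> {0..<n} \<and> card S = k} \<subseteq> increasing_tuple_set n k"
  proof (rule image_subsetI)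
    fix S assume "S \<in> {S. S \<subseteq> {0..<n} \<and> card S = k}"
    moreover from this have "finite S"
      using finite_subset by blast
    ultimately show "sorted_list_of_set S \<in> increasing_tuple_set n k"
      by (simp add: increasing_tuple_set_def)
  qed
qed

lemma finite_increasing_tuple_set [simp]: "finite (increasing_tuple_set n k)"
  using bij_betw_finite[OF bij_betw_increasing_tuple_set[of n k]] by simp

lemma length_increasing_tuples [simp]: "length (increasing_tuples n k) = n choose k"
  using bij_betw_same_card[OF bij_betw_increasing_tuple_set[of n k]]
  by (simp add: increasing_tuples_def n_subsets)

lemma set_increasing_tuples [simp]: "set (increasing_tuples n k) = increasing_tuple_set n k"
  by (simp add: increasing_tuples_def)

lemma sorted_increasing_tuples: "sorted_wrt (<) (increasing_tuples n k)"
  by (simp add: increasing_tuples_def)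

text \<open>
  \<^const>\<open>submatrix\<close> takes the index sets of the selected rows and columns and lists them
  in increasing order, so passing the set of an increasing tuple loses no information.
\<close>

definition compound_mat :: "nat \<Rightarrow> 'a :: comm_ring_1 mat \<Rightarrow> 'a mat" where
  "compound_mat k X =
     mat (dim_row X choose k) (dim_col X choose k)
       (\<lambda>(i, j). det (submatrix X (set (increasing_tuples (dim_row X) k ! i))
                                  (set (increasing_tuples (dim_col X) k ! j))))"

abbreviation mat_rank :: "'a :: field mat \<Rightarrow> nat" where
  "mat_rank X \<equiv> vec_space.rank (dim_row X) X"

definition rank_revealing_factorization ::
  "'a :: field mat \<Rightarrow> 'a mat \<Rightarrow> 'a mat \<Rightarrow> bool" where
  "rank_revealing_factorization A U V \<longleftrightarrow>
     U \<in> carrier_mat (dim_row A) (mat_rank A) \<and>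
     V \<in> carrier_mat (dim_col A) (mat_rank A) \<and>
     mat_rank U = mat_rank A \<and>
     mat_rank V = mat_rank A \<and>
     A = U * transpose_mat V"

end

theory Submission
  imports Defs "Jordan_Normal_Form.DL_Rank_Submatrix"
begin

text \<open>
  Part (1) holds because the rank of a matrix is the largest size of a nonzero minor.
  For part (2), multiplicativity of the determinant gives
  det(A[f,g]) = det(U[f]) det(V[g]) for all choices f of k rows and g of k columns, so B has
  minors of this form as well. Expanding det(B[f,g]) and det(U[f]) along one row j, after
  replacing that row by row i of B and of U respectively, shows that for every i the combination
  of the entries B(i, g l) with the cofactors of B[f,g] equals a combination, with coefficients
  independent of i, of the entries of row i of U. Varying g, this puts every column of B into
  the column space of U. By transposition the rows of B lie in the column space of V, so that
  B = U T V^T, and comparing one nonzero minor yields det T = 1.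
\<close>

section \<open>Minors with arbitrary row and column selections\<close>

text \<open>Unlike \<^const>\<open>submatrix\<close>, rows and columns may be listed in any order and
  repeatedly, so that a single row or column can be exchanged by a function update.\<close>

definition select_mat :: "nat \<Rightarrow> 'a mat \<Rightarrow> (nat \<Rightarrow> nat) \<Rightarrow> (nat \<Rightarrow> nat) \<Rightarrow> 'a mat" where
  "select_mat k X f g = mat k k (\<lambda>(i, j). X $$ (f i, g j))"

lemma select_mat_carrier [simp]: "select_mat k X f g \<in> carrier_mat k k"
  by (simp add: select_mat_def)

lemma select_mat_dim [simp]:
  "dim_row (select_mat k X f g) = k" "dim_col (select_mat k X f g) = k"
  by (simp_all add: select_mat_def)

lemma select_mat_index [simp]:
  "i < k \<Longrightarrow> j < k \<Longrightarrow> select_mat k X f g $$ (i, j) = X $$ (f i, g j)"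
  by (simp add: select_mat_def)

lemma transpose_select_mat:
  assumes "X \<in> carrier_mat n m" "\<And>i. i < k \<Longrightarrow> f i < n" "\<And>j. j < k \<Longrightarrow> g j < m"
  shows "transpose_mat (select_mat k X f g) = select_mat k (transpose_mat X) g f"
  using assms by (intro eq_matI) auto

lemma pick_less:
  assumes "I \<subseteq> {0..<n}" "i < card I"
  shows "pick I i < n"
  using pick_in_set_le[OF assms(2)] assms(1) by auto

lemma submatrix_eq_select_mat:
  assumes "X \<in> carrier_mat n m" "I \<subseteq> {0..<n}" "card I = k" "J \<subseteq> {0..<m}" "card J = k"
  shows "submatrix X I J = select_mat k X (pick I) (pick J)"
proof -
  have "{i. i < n \<and> i \<in> I} = I" "{j. j < m \<and> j \<in> J} = J"
    using assms by auto
  thus ?thesis using assms by (simp add: submatrix_def select_mat_def)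
qed

text \<open>Sorting the rows costs the sign of a permutation if \<open>f\<close> is injective;
  otherwise two rows coincide and the factor is 0. Since \<open>c\<close> and \<open>I\<close>
  depend on \<open>f\<close> alone and not on \<open>h\<close>, one choice serves several matrices
  at once.\<close>

lemma det_reindex_rows:
  assumes f: "\<And>i. i < k \<Longrightarrow> f i < n" and kn: "k \<le> n"
  obtains c :: "'a :: comm_ring_1" and I where "I \<subseteq> {0..<n}" "card I = k"
    "\<And>h. det (mat k k (\<lambda>(i, j). h (f i) j)) = c * det (mat k k (\<lambda>(i, j). h (pick I i) j))"
proof (cases "inj_on f {0..<k}")
  case True
  define I where "I = f ` {0..<k}"
  \<comment> \<open>\<open>p i\<close> is the position of \<open>f i\<close> in the sorted set
    \<open>I\<close>; being the identity from \<open>k\<close> on makes it a permutation of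
    \<open>{0..<k}\<close>.\<close>
  define p where "p i = (if i < k then card {a \<in> I. a < f i} else i)" for i
  have I: "finite I" "I \<subseteq> {0..<n}" "card I = k"
    using f True by (auto simp: I_def card_image)
  have pick: "pick I (p i) = f i" if "i < k" for i
    using that by (simp add: p_def I_def pick_card_in_set)
  have pk: "p i < k" if "i < k" for i
  proof -
    have "{a \<in> I. a < f i} \<subset> I"
      using that by (auto simp: I_def)
    thus ?thesis
      using psubset_card_mono[OF I(1)] I(3) that by (simp add: p_def)
  qed
  have inj: "inj_on p {0..<k}"
    using True pick by (metis (no_types, lifting) inj_on_def atLeastLessThan_iff)
  have "p ` {0..<k} = {0..<k}"
    using inj pk by (intro card_subset_eq) (auto simp: card_image)
  hence p: "p permutes {0..<k}"
    using inj by (intro bij_imp_permutes) (auto simp: bij_betw_def p_def)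
  show ?thesis
  proof (rule that[OF I(2,3), of "signof p"])
    fix h :: "nat \<Rightarrow> nat \<Rightarrow> 'a"
    let ?M = "mat k k (\<lambda>(i, j). h (pick I i) j)"
    have "mat k k (\<lambda>(i, j). h (f i) j) = mat k k (\<lambda>(i, j). ?M $$ (p i, j))"
      using pk pick by (intro eq_matI) auto
    thus "det (mat k k (\<lambda>(i, j). h (f i) j)) = signof p * det ?M"
      using det_permute_rows[OF _ p, of ?M] by simp
  qed
next
  case False
  then obtain i j where ij: "i < k" "j < k" "i \<noteq> j" "f i = f j"
    by (auto simp: inj_on_def)
  show ?thesis
  \<comment> \<open>With factor 0 any k-subset will do; \<open>k \<le> n\<close> provides this
    one.\<close>
  proof (rule that[of "{0..<k}" 0])
    fix h :: "nat \<Rightarrow> nat \<Rightarrow> 'a"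
    have "det (mat k k (\<lambda>(i, j). h (f i) j)) = 0"
      using ij by (intro det_identical_rows[of _ k i j]) (auto intro!: eq_vecI)
    thus "det (mat k k (\<lambda>(i, j). h (f i) j)) = 0 * det (mat k k (\<lambda>(a, b). h (pick {0..<k} a) b))"
      by simp
  qed (use kn in auto)
qed

text \<open>Rows are sorted first, then columns after transposing. Again \<open>c\<close>,
  \<open>I\<close>, \<open>J\<close> are fixed before \<open>X\<close>, so they can be shared by
  \<open>A\<close> and \<open>B\<close>.\<close>

lemma det_select_reindex:
  assumes f: "\<And>i. i < k \<Longrightarrow> f i < n" and g: "\<And>j. j < k \<Longrightarrow> g j < m"
    and k: "k \<le> min n m"
  obtains c :: "'a :: comm_ring_1" and I J
  where "I \<subseteq> {0..<n}" "card I = k" "J \<subseteq> {0..<m}" "card J = k"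
    "\<And>X. X \<in> carrier_mat n m \<Longrightarrow> det (select_mat k X f g) = c * det (submatrix X I J)"
proof -
  obtain c :: 'a and I where I: "I \<subseteq> {0..<n}" "card I = k"
    and c: "\<And>h. det (mat k k (\<lambda>(i, j). h (f i) j)) = c * det (mat k k (\<lambda>(i, j). h (pick I i) j))"
    using det_reindex_rows[of k f n] f k by (metis min.boundedE)
  obtain d :: 'a and J where J: "J \<subseteq> {0..<m}" "card J = k"
    and d: "\<And>h. det (mat k k (\<lambda>(i, j). h (g i) j)) = d * det (mat k k (\<lambda>(i, j). h (pick J i) j))"
    using det_reindex_rows[of k g m] g k by (metis min.boundedE)
  show ?thesis
  proof (rule that[OF I J, of "c * d"])
    fix X :: "'a mat" assume X: "X \<in> carrier_mat n m"
    have tr: "mat k k (\<lambda>(i, j). h j i) = transpose_mat (mat k k (\<lambda>(i, j). h i j))"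
      for h :: "nat \<Rightarrow> nat \<Rightarrow> 'a" by (intro eq_matI) auto
    have swap: "det (mat k k (\<lambda>(i, j). h j i)) = det (mat k k (\<lambda>(i, j). h i j))"
      for h :: "nat \<Rightarrow> nat \<Rightarrow> 'a" 
      using det_transpose[of "mat k k (\<lambda>(i, j). h i j)" k] by (simp add: tr[of h])
    have "det (select_mat k X f g) = c * det (mat k k (\<lambda>(i, j). X $$ (pick I i, g j)))"
      unfolding select_mat_def using c[of "\<lambda>i j. X $$ (i, g j)"] .
    also have "det (mat k k (\<lambda>(i, j). X $$ (pick I i, g j))) =
        det (mat k k (\<lambda>(i, j). X $$ (pick I j, g i)))"
      by (rule swap[of "\<lambda>i j. X $$ (pick I j, g i)"])
    also have "\<dots> = d * det (mat k k (\<lambda>(i, j). X $$ (pick I j, pick J i)))"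
      by (rule d[of "\<lambda>i j. X $$ (pick I j, i)"])
    also have "det (mat k k (\<lambda>(i, j). X $$ (pick I j, pick J i))) =
        det (select_mat k X (pick I) (pick J))"
      unfolding select_mat_def by (rule swap[of "\<lambda>i j. X $$ (pick I i, pick J j)"])
    finally show "det (select_mat k X f g) = c * d * det (submatrix X I J)"
      by (simp add: submatrix_eq_select_mat[OF X I J] mult.assoc)
  qed
qed

section \<open>Equality of compounds as equality of minors\<close>

lemma compound_mat_eq_iff_submatrix:
  assumes "A \<in> carrier_mat n m" "B \<in> carrier_mat n m"
  shows "compound_mat k A = compound_mat k B \<longleftrightarrow>
    (\<forall>I J. I \<subseteq> {0..<n} \<longrightarrow> card I = k \<longrightarrow> J \<subseteq> {0..<m} \<longrightarrow> card J = k \<longrightarrow>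
      det (submatrix A I J) = det (submatrix B I J))" (is "?L \<longleftrightarrow> ?R")
proof
  have idx: "\<exists>i < N choose k. set (increasing_tuples N k ! i) = I" if "I \<subseteq> {0..<N}" "card I = k" for I N
  proof -
    have "I \<in> set ` set (increasing_tuples N k)"
      using bij_betw_imp_surj_on[OF bij_betw_increasing_tuple_set[of N k]] that by auto
    thus ?thesis by (auto simp: in_set_conv_nth simp del: set_increasing_tuples)
  qed
  assume L: ?L
  show ?R
  proof (intro allI impI)
    fix I J assume *: "I \<subseteq> {0..<n}" "card I = k" "J \<subseteq> {0..<m}" "card J = k"
    obtain i where i: "i < n choose k" "set (increasing_tuples n k ! i) = I"
      using idx[OF *(1,2)] by blast
    obtain j where j: "j < m choose k" "set (increasing_tuples m k ! j) = J"
      using idx[OF *(3,4)] by blast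
    have "compound_mat k X $$ (i, j) = det (submatrix X I J)" if "X \<in> carrier_mat n m" for X :: "'a mat"
      using that i j by (simp add: compound_mat_def)
    thus "det (submatrix A I J) = det (submatrix B I J)"
      using L assms by metis
  qed
next
  have idx: "set (increasing_tuples N k ! i) \<subseteq> {0..<N} \<and> card (set (increasing_tuples N k ! i)) = k"
    if "i < N choose k" for i N
  proof -
    have "increasing_tuples N k ! i \<in> increasing_tuple_set N k"
      using that nth_mem[of i "increasing_tuples N k"] by simp
    thus ?thesis
      using bij_betw_imp_surj_on[OF bij_betw_increasing_tuple_set[of N k]] by blast
  qed
  assume ?R
  thus ?L using assms idx
    by (intro eq_matI) (auto simp: compound_mat_def)
qed

text \<open>Frees the index selections from being increasing, so that later a single row or column
  can be exchanged without leaving the class of minors considered.\<close>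

lemma compound_mat_eq_iff_select:
  assumes A: "A \<in> carrier_mat n m" and B: "B \<in> carrier_mat n m" and k: "k \<le> min n m"
  shows "compound_mat k A = compound_mat k B \<longleftrightarrow>
    (\<forall>f g. (\<forall>i<k. f i < n) \<longrightarrow> (\<forall>j<k. g j < m) \<longrightarrow>
      det (select_mat k A f g) = det (select_mat k B f g))" (is "_ \<longleftrightarrow> ?R")
  unfolding compound_mat_eq_iff_submatrix[OF A B]
proof (intro iffI allI impI)
  fix f g assume *: "\<forall>I J. I \<subseteq> {0..<n} \<longrightarrow> card I = k \<longrightarrow> J \<subseteq> {0..<m} \<longrightarrow> card J = k \<longrightarrow>
      det (submatrix A I J) = det (submatrix B I J)" and "\<forall>i<k. f i < n" "\<forall>j<k. g j < m"
  then obtain c :: 'a and I J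
    where "I \<subseteq> {0..<n}" "card I = k" "J \<subseteq> {0..<m}" "card J = k"
    "\<And>X. X \<in> carrier_mat n m \<Longrightarrow> det (select_mat k X f g) = c * det (submatrix X I J)"
    using det_select_reindex[of k f n g m] k by metis
  thus "det (select_mat k A f g) = det (select_mat k B f g)"
    using * A B by simp
next
  fix I J assume *: ?R and IJ: "I \<subseteq> {0..<n}" "card I = k" "J \<subseteq> {0..<m}" "card J = k"
  have "\<forall>i<k. pick I i < n" "\<forall>j<k. pick J j < m"
    using IJ pick_less by auto
  thus "det (submatrix A I J) = det (submatrix B I J)"
    using * submatrix_eq_select_mat[OF A IJ] submatrix_eq_select_mat[OF B IJ] by simp
qed

section \<open>Rank and vanishing minors\<close>

text \<open>The columns of the product lie in the span of the \<open>p\<close> columns of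
  \<open>Y\<close>.\<close>

lemma (in vec_space) rank_mult_le:
  assumes Y: "Y \<in> carrier_mat n p" and Z: "Z \<in> carrier_mat p m"
  shows "rank (Y * Z) \<le> p"
proof -
  let ?C = "\<lambda>X. span (set (cols X))"
  have carr: "set (cols X) \<subseteq> carrier_vec n" if "X \<in> carrier_mat n q" for X q
    using that by (auto dest!: subsetD[OF cols_dim])
  have YZ: "Y * Z \<in> carrier_mat n m" using Y Z by simp
  have sub: "set (cols (Y * Z)) \<subseteq> ?C Y"
  proof
    fix v assume "v \<in> set (cols (Y * Z))"
    then obtain j where j: "j < m" "v = Y *\<^sub>v col Z j"
      using Y Z by (auto simp: in_set_conv_nth mult_mat_vec_def)
    show "v \<in> ?C Y"
      using col_space_eq[OF Y] Y Z j by (force simp: col_space_def)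
  qed
  have "?C (Y * Z) \<subseteq> ?C Y"
    by (rule span_subsetI[OF carr[OF Y] sub])
  hence "VectorSpace.subspace class_ring (?C (Y * Z)) (vs (?C Y))"
    using nested_subspaces[OF span_is_subspace span_is_subspace] carr[OF Y] carr[OF YZ] by simp
  moreover have "vectorspace class_ring (vs (?C Y))"
    using span_is_subspace[OF carr[OF Y]] subspace_is_vs by blast
  ultimately have "rank (Y * Z) \<le> rank Y"
    unfolding rank_def
    using vectorspace.subspace_dim[of class_ring "vs (?C Y)" "?C (Y * Z)"]
      fin_dim_span_cols[OF Y] fin_dim_span_cols[OF YZ] by simp
  thus ?thesis using rank_le_nc[OF Y] by simp
qed

text \<open>Laplace expansion along row \<open>j\<close>: its cofactors delete that row, hence do
  not see the update and are independent of \<open>i\<close>.\<close>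

lemma det_select_row_upd:
  assumes "j < k"
  shows "det (select_mat k X (f(j := i)) g) =
    (\<Sum>l<k. X $$ (i, g l) * cofactor (select_mat k X f g) j l)"
proof -
  have "mat_delete (select_mat k X (f(j := i)) g) j l = mat_delete (select_mat k X f g) j l" for l
    using assms by (intro eq_matI) (auto simp: mat_delete_def)
  hence "cofactor (select_mat k X (f(j := i)) g) j l = cofactor (select_mat k X f g) j l" for l
    by (simp add: cofactor_def)
  thus ?thesis
    using laplace_expansion_row[of "select_mat k X (f(j := i)) g" k j] assms by simp
qed

lemma cofactor_select_col_upd:
  assumes "l < k"
  shows "cofactor (select_mat k X f (g(l := c))) j l = cofactor (select_mat k X f g) j l"
proof -
  have "mat_delete (select_mat k X f (g(l := c))) j l = mat_delete (select_mat k X f g) j l"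
    using assms by (intro eq_matI) (auto simp: mat_delete_def)
  thus ?thesis by (simp add: cofactor_def)
qed

lemma cofactor_select_last:
  "cofactor (select_mat (Suc p) X f g) p p = det (select_mat p X f g)"
proof -
  have "mat_delete (select_mat (Suc p) X f g) p p = select_mat p X f g"
    by (intro eq_matI) (auto simp: mat_delete_def)
  thus ?thesis by (simp add: cofactor_def)
qed

text \<open>A nonzero minor that cannot be enlarged has size \<open>p < k\<close>, and its columns
  span all columns of \<open>X\<close>, so \<open>X\<close> factors through dimension
  \<open>p\<close>.\<close>

lemma vanishing_minors_rank_less:
  fixes X :: "'a :: field mat"
  assumes X: "X \<in> carrier_mat n m"
    and van: "\<And>f g. (\<And>i. i < k \<Longrightarrow> f i < n) \<Longrightarrow> (\<And>j. j < k \<Longrightarrow> g j < m) \<Longrightarrow>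
      det (select_mat k X f g) = 0"
  shows "vec_space.rank n X < k"
proof -
  define P where "P p \<longleftrightarrow> (\<exists>f g. (\<forall>i<p. f i < n) \<and> (\<forall>j<p. g j < m) \<and>
      det (select_mat p X f g) \<noteq> 0)" for p
  \<comment> \<open>The empty determinant is 1, so below \<open>k\<close> there is a last size
    before the minors first all vanish.\<close>
  have "P 0" by (auto simp: P_def)
  moreover have "\<not> P k" using van unfolding P_def by blast
  ultimately obtain p where p: "p < k" "P p" "\<not> P (Suc p)"
    using ex_least_nat_less[of "\<lambda>p. \<not> P p" k] by auto
  from p(2) obtain f g where f: "\<And>i. i < p \<Longrightarrow> f i < n" and g: "\<And>j. j < p \<Longrightarrow> g j < m"
    and D: "det (select_mat p X f g) \<noteq> 0" by (auto simp: P_def)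
  define D where "D = det (select_mat p X f g)"
  \<comment> \<open>The bordered minor with extra row i and column c vanishes; its cofactors along the
    row i do not depend on i, so column c is a fixed combination of the columns g.\<close>
  define C where "C c l = cofactor (select_mat (Suc p) X f (g(p := c))) p l" for c l
  define Y where "Y = mat n p (\<lambda>(i, j). X $$ (i, g j))"
  define Z where "Z = mat p m (\<lambda>(l, c). - C c l / D)"
  have YZ: "Y \<in> carrier_mat n p" "Z \<in> carrier_mat p m" by (auto simp: Y_def Z_def)
  have entry: "X $$ (i, c) = (\<Sum>l<p. X $$ (i, g l) * (- C c l / D))" if "i < n" "c < m" for i c
  proof -
    have "det (select_mat (Suc p) X (f(p := i)) (g(p := c))) = 0"
    proof (rule ccontr)
      assume "det (select_mat (Suc p) X (f(p := i)) (g(p := c))) \<noteq> 0"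
      hence "P (Suc p)" unfolding P_def using f g that
        by (intro exI[of _ "f(p := i)"] exI[of _ "g(p := c)"]) (auto simp: less_Suc_eq)
      thus False using p(3) by simp
    qed
    hence "(\<Sum>l<Suc p. X $$ (i, (g(p := c)) l) * C c l) = 0"
      by (subst (asm) det_select_row_upd) (auto simp: C_def)
    \<comment> \<open>Deleting row and column \<open>p\<close> removes both the unconstrained index
      \<open>f p\<close> and the new column \<open>c\<close>.\<close>
    moreover have "C c p = D"
      unfolding C_def D_def cofactor_select_last
      by (rule arg_cong[of _ _ det]) (auto intro!: eq_matI)
    ultimately have "X $$ (i, c) * D = - (\<Sum>l<p. X $$ (i, g l) * C c l)"
      by (simp add: eq_neg_iff_add_eq_0 add.commute)
    thus ?thesis using D
      by (simp add: D_def[symmetric] sum_negf sum_divide_distrib[symmetric] field_simps)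
  qed
  have "X = Y * Z"
  proof (rule eq_matI)
    fix i c assume "i < dim_row (Y * Z)" "c < dim_col (Y * Z)"
    hence "i < n" "c < m" by (auto simp: Y_def Z_def)
    thus "X $$ (i, c) = (Y * Z) $$ (i, c)"
      using entry by (simp add: Y_def Z_def scalar_prod_def atLeast0LessThan)
  qed (use X in \<open>auto simp: Y_def Z_def\<close>)
  thus ?thesis
    using vec_space.rank_mult_le[OF YZ] p(1) by simp
qed

text \<open>The zero matrix serves as a common reference against which \<open>A\<close> and
  \<open>B\<close> are both compared in part (1).\<close>

lemma compound_mat_eq_zero_iff:
  fixes X :: "'a :: field mat"
  assumes X: "X \<in> carrier_mat n m" and k: "1 \<le> k" "k \<le> min n m"
  shows "compound_mat k X = compound_mat k (0\<^sub>m n m) \<longleftrightarrow> mat_rank X < k"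
proof
  have zero: "det (select_mat k (0\<^sub>m n m :: 'a mat) f g) = 0"
    if "\<And>i. i < k \<Longrightarrow> f i < n" "\<And>j. j < k \<Longrightarrow> g j < m" for f g
  proof -
    have "select_mat k (0\<^sub>m n m) f g = (0\<^sub>m k k :: 'a mat)"
      using that by (intro eq_matI) auto
    thus ?thesis using k by simp
  qed
  {
    assume "compound_mat k X = compound_mat k (0\<^sub>m n m)"
    hence "vec_space.rank n X < k"
      using zero compound_mat_eq_iff_select[OF X zero_carrier_mat k(2)]
      by (intro vanishing_minors_rank_less[OF X]) auto
    thus "mat_rank X < k" using X by simp
  next
    assume r: "mat_rank X < k"
    show "compound_mat k X = compound_mat k (0\<^sub>m n m)"
      unfolding compound_mat_eq_iff_submatrix[OF X zero_carrier_mat]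
    proof (intro allI impI)
      fix I J assume IJ: "I \<subseteq> {0..<n}" "card I = k" "J \<subseteq> {0..<m}" "card J = k"
      have "{j. j < m \<and> j \<in> J} = J" using IJ by auto
      hence "det (submatrix X I J) = 0"
        using vec_space.rank_gt_minor[OF X, of I J] r X IJ by auto
      moreover have "\<And>i. i < k \<Longrightarrow> pick I i < n" "\<And>j. j < k \<Longrightarrow> pick J j < m"
        using IJ pick_less by auto
      ultimately show "det (submatrix X I J) = det (submatrix (0\<^sub>m n m) I J)"
        unfolding submatrix_eq_select_mat[OF zero_carrier_mat IJ] using zero by simp
    qed
  }
qed

section \<open>Minors of products and recovery of the factors\<close>

text \<open>The inner dimension equals the size of the minor, so \<open>id\<close> takes every inner
  index; this is the case of Cauchy-Binet with a single summand.\<close>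

lemma select_mat_mult:
  assumes "X \<in> carrier_mat n k" "Y \<in> carrier_mat k m"
    and "\<And>i. i < k \<Longrightarrow> f i < n" "\<And>j. j < k \<Longrightarrow> g j < m"
  shows "select_mat k (X * Y) f g = select_mat k X f id * select_mat k Y id g"
  using assms by (intro eq_matI) (auto simp: scalar_prod_def)

lemma det_select_mult:
  fixes U :: "'a :: idom mat"
  assumes U: "U \<in> carrier_mat n k" and T: "T \<in> carrier_mat k k" and V: "V \<in> carrier_mat m k"
    and f: "\<And>i. i < k \<Longrightarrow> f i < n" and g: "\<And>j. j < k \<Longrightarrow> g j < m"
  shows "det (select_mat k (U * T * transpose_mat V) f g) =
    det (select_mat k U f id) * det T * det (select_mat k V g id)"
proof -
  have "select_mat k T id id = T"
    using T by (intro eq_matI) auto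
  hence UT: "select_mat k (U * T) f id = select_mat k U f id * T"
    using select_mat_mult[OF U T f, of id] by simp
  have "select_mat k (transpose_mat V) id g = transpose_mat (select_mat k V g id)"
    using transpose_select_mat[OF V, of k g id] g by simp
  hence "select_mat k (U * T * transpose_mat V) f g =
      select_mat k U f id * T * transpose_mat (select_mat k V g id)"
    using select_mat_mult[of "U * T" n k "transpose_mat V" m f g] U T V f g by (simp only: UT) simp
  thus ?thesis
    using T det_mult[OF mult_carrier_mat[OF select_mat_carrier T],
        of "transpose_mat (select_mat k V g id)"]
      det_mult[of "select_mat k U f id" k T] det_transpose[of "select_mat k V g id" k]
    by (simp del: assoc_mult_mat)
qed

text \<open>First the columns \<open>g\<close> of \<open>B\<close> are expressed through
  \<open>U\<close> by inverting the cofactor matrix, then any other column by exchanging it for one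
  of these. Leaving \<open>v\<close> abstract lets the lemma apply both to \<open>B\<close> with
  \<open>U\<close> and to the transpose of \<open>B\<close> with \<open>V\<close>.\<close>

lemma factor_of_factored_minors:
  fixes B U :: "'a :: field mat"
  assumes B: "B \<in> carrier_mat n m" and U: "U \<in> carrier_mat n k" and k: "0 < k"
    and minors: "\<And>f g. (\<And>i. i < k \<Longrightarrow> f i < n) \<Longrightarrow> (\<And>j. j < k \<Longrightarrow> g j < m) \<Longrightarrow>
      det (select_mat k B f g) = det (select_mat k U f id) * v g"
    and f: "\<And>i. i < k \<Longrightarrow> f i < n" and g: "\<And>j. j < k \<Longrightarrow> g j < m"
    and nz: "det (select_mat k B f g) \<noteq> 0"
  obtains Z where "Z \<in> carrier_mat k m" "B = U * Z"
proof -
  define M where "M = select_mat k B f g"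
  define N where "N = select_mat k U f id"
  have M: "M \<in> carrier_mat k k" by (simp add: M_def)
  \<comment> \<open>Row \<open>j\<close> is replaced by row \<open>i\<close> in the minors of
    \<open>B\<close> and of \<open>U\<close>, and both are expanded along it.\<close>
  have expand: "(\<Sum>l<k. B $$ (i, h l) * cofactor (select_mat k B f h) j l) =
      (\<Sum>q<k. U $$ (i, q) * (v h * cofactor N j q))"
    if "i < n" "j < k" "\<And>l. l < k \<Longrightarrow> h l < m" for i j h
    using minors[of "f(j := i)" h] that f
    by (simp add: det_select_row_upd N_def sum_distrib_left mult_ac)
  have adj: "(\<Sum>j<k. cofactor M j l * M $$ (j, l')) = (if l = l' then det M else 0)"
    if "l < k" "l' < k" for l l'
  proof -
    have "(adj_mat M * M) $$ (l, l') = (det M \<cdot>\<^sub>m 1\<^sub>m k) $$ (l, l')"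
      using adj_mat(3)[OF M] by simp
    thus ?thesis
      using that M by (simp add: adj_mat_def scalar_prod_def atLeast0LessThan)
  qed
  \<comment> \<open>Weighting the relation for row \<open>j\<close> by \<open>M $$ (j, l)\<close>
    and summing over \<open>j\<close> leaves only \<open>B $$ (i, g l) * det M\<close> on the left,
    by \<open>adj\<close>; \<open>y\<close> collects the coefficients on the right.\<close>
  define y where "y l q = (\<Sum>j<k. v g * cofactor N j q * M $$ (j, l)) / det M" for l q
  have basic: "B $$ (i, g l) = (\<Sum>q<k. U $$ (i, q) * y l q)" if "i < n" "l < k" for i l
  proof -
    have "B $$ (i, g l) * det M = (\<Sum>l'<k. B $$ (i, g l') * (if l' = l then det M else 0))"
      using that by (simp add: if_distrib cong: if_cong)
    also have "\<dots> = (\<Sum>l'<k. \<Sum>j<k. B $$ (i, g l') * (cofactor M j l' * M $$ (j, l)))"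
      using that by (simp add: adj sum_distrib_left[symmetric])
    also have "\<dots> = (\<Sum>j<k. \<Sum>l'<k. B $$ (i, g l') * (cofactor M j l' * M $$ (j, l)))"
      by (rule sum.swap)
    also have "\<dots> = (\<Sum>j<k. (\<Sum>l'<k. B $$ (i, g l') * cofactor M j l') * M $$ (j, l))"
      by (simp add: sum_distrib_left sum_distrib_right mult_ac)
    also have "\<dots> = (\<Sum>j<k. (\<Sum>q<k. U $$ (i, q) * (v g * cofactor N j q)) * M $$ (j, l))"
      using expand[OF that(1) _ g] by (simp add: M_def)
    also have "\<dots> = (\<Sum>j<k. \<Sum>q<k. U $$ (i, q) * (v g * cofactor N j q * M $$ (j, l)))"
      by (simp only: sum_distrib_right mult.assoc)
    also have "\<dots> = (\<Sum>q<k. \<Sum>j<k. U $$ (i, q) * (v g * cofactor N j q * M $$ (j, l)))"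
      by (rule sum.swap)
    also have "\<dots> = (\<Sum>q<k. U $$ (i, q) * (y l q * det M))"
      using nz by (simp add: y_def M_def[symmetric] sum_distrib_left)
    also have "\<dots> = (\<Sum>q<k. U $$ (i, q) * y l q) * det M"
      by (simp only: sum_distrib_right mult.assoc)
    finally show ?thesis using nz by (simp add: M_def)
  qed
  \<comment> \<open>Some term of the expansion of \<open>det M\<close> along row 0 is nonzero; row 0
    exists because \<open>0 < k\<close>.\<close>
  obtain l0 where l0: "l0 < k" "cofactor M 0 l0 \<noteq> 0"
  proof -
    have "(\<Sum>l<k. M $$ (0, l) * cofactor M 0 l) \<noteq> 0"
      using laplace_expansion_row[OF M k] nz by (simp add: M_def)
    then obtain l where "l \<in> {..<k}" "M $$ (0, l) * cofactor M 0 l \<noteq> 0"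
      by (meson sum.not_neutral_contains_not_neutral)
    thus ?thesis using that by auto
  qed
  \<comment> \<open>Exchanging column l0 for c keeps the cofactor at l0, so the expansion
    can be solved for column c.\<close>
  define E where "E c l = cofactor (select_mat k B f (g(l0 := c))) 0 l" for c l
  define w where "w c q = (v (g(l0 := c)) * cofactor N 0 q - (\<Sum>l\<in>{..<k}-{l0}. y l q * E c l)) /
      cofactor M 0 l0" for c q
  have entry: "B $$ (i, c) = (\<Sum>q<k. U $$ (i, q) * w c q)" if "i < n" "c < m" for i c
  proof -
    have E0: "E c l0 = cofactor M 0 l0"
      unfolding E_def M_def by (rule cofactor_select_col_upd[OF l0(1)])
    have "(\<Sum>l<k. B $$ (i, (g(l0 := c)) l) * E c l) =
        (\<Sum>q<k. U $$ (i, q) * (v (g(l0 := c)) * cofactor N 0 q))"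
      unfolding E_def using that g k by (intro expand) auto
    moreover have "(\<Sum>l<k. B $$ (i, (g(l0 := c)) l) * E c l) =
        B $$ (i, c) * cofactor M 0 l0 + (\<Sum>l\<in>{..<k}-{l0}. B $$ (i, g l) * E c l)"
      using l0 by (subst sum.remove[of _ l0]) (auto simp: E0)
    \<comment> \<open>The other selected columns are eliminated by \<open>basic\<close>, leaving
      only column \<open>c\<close> unknown.\<close>
    moreover have "(\<Sum>l\<in>{..<k}-{l0}. B $$ (i, g l) * E c l) =
        (\<Sum>q<k. U $$ (i, q) * (\<Sum>l\<in>{..<k}-{l0}. y l q * E c l))"
    proof -
      have "(\<Sum>l\<in>{..<k}-{l0}. B $$ (i, g l) * E c l) =
          (\<Sum>l\<in>{..<k}-{l0}. \<Sum>q<k. U $$ (i, q) * (y l q * E c l))"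
        using basic[OF that(1)] by (simp add: sum_distrib_right mult.assoc)
      thus ?thesis by (subst (asm) sum.swap) (simp add: sum_distrib_left)
    qed
    ultimately have "B $$ (i, c) * cofactor M 0 l0 =
        (\<Sum>q<k. U $$ (i, q) * (v (g(l0 := c)) * cofactor N 0 q)) -
        (\<Sum>q<k. U $$ (i, q) * (\<Sum>l\<in>{..<k}-{l0}. y l q * E c l))"
      by (simp add: eq_diff_eq)
    also have "\<dots> = (\<Sum>q<k. U $$ (i, q) * w c q) * cofactor M 0 l0"
      using l0(2) by (simp add: w_def sum_distrib_right sum_subtractf[symmetric] right_diff_distrib)
    finally show ?thesis using l0(2) by simp
  qed
  show ?thesis
  proof (rule that[of "mat k m (\<lambda>(q, c). w c q)"])
    show "B = U * mat k m (\<lambda>(q, c). w c q)"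
      using B U entry by (intro eq_matI) (auto simp: scalar_prod_def atLeast0LessThan)
  qed simp
qed

text \<open>Restricting \<open>B = U * Z\<close> and the transposed factorization through
  \<open>V\<close> to the rows \<open>f\<close> gives \<open>P * Z = R * transpose_mat V\<close>
  with \<open>P\<close> invertible, which is solved for \<open>Z\<close>.\<close>

lemma factor_through_both:
  fixes B U V :: "'a :: field mat"
  assumes B: "B \<in> carrier_mat n m" and U: "U \<in> carrier_mat n k" and V: "V \<in> carrier_mat m k"
    and Z: "Z \<in> carrier_mat k m" "B = U * Z" and W: "W \<in> carrier_mat k n" "transpose_mat B = V * W"
    and f: "\<And>i. i < k \<Longrightarrow> f i < n" and nz: "det (select_mat k U f id) \<noteq> 0"
  obtains T where "T \<in> carrier_mat k k" "B = U * T * transpose_mat V"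
proof -
  define P where "P = select_mat k U f id"
  have P: "P \<in> carrier_mat k k" by (simp add: P_def)
  \<comment> \<open>The inverse of \<open>P\<close>, by the adjugate formula.\<close>
  define Q where "Q = (1 / det P) \<cdot>\<^sub>m adj_mat P"
  have Q: "Q \<in> carrier_mat k k" using adj_mat(1)[OF P] by (simp add: Q_def)
  have QP: "Q * P = 1\<^sub>m k"
    using adj_mat[OF P] nz P by (simp add: Q_def P_def[symmetric] mult_smult_assoc_mat[of _ k k])
      (auto intro!: eq_matI)
  \<comment> \<open>The rows \<open>f\<close> of \<open>transpose_mat W\<close>.\<close>
  define R where "R = mat k k (\<lambda>(i, j). W $$ (j, f i))"
  have R: "R \<in> carrier_mat k k" by (simp add: R_def)
  have BW: "B = transpose_mat W * transpose_mat V"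
    using W V by (metis transpose_mult transpose_transpose)
  have "P * Z = R * transpose_mat V"
  proof (rule eq_matI)
    fix i j assume "i < dim_row (R * transpose_mat V)" "j < dim_col (R * transpose_mat V)"
    hence ij: "i < k" "j < m" using V by (auto simp: R_def)
    have "row P i = row U (f i)"
      using U f ij by (intro eq_vecI) (auto simp: P_def)
    hence "(P * Z) $$ (i, j) = B $$ (f i, j)"
      using Z U P f ij by simp
    moreover have "row R i = row (transpose_mat W) (f i)"
      using W f ij by (intro eq_vecI) (auto simp: R_def)
    hence "(R * transpose_mat V) $$ (i, j) = B $$ (f i, j)"
      using BW V W R f ij by simp
    ultimately show "(P * Z) $$ (i, j) = (R * transpose_mat V) $$ (i, j)" by simp
  qed (use P Z R V in auto)
  hence "Q * (P * Z) = Q * (R * transpose_mat V)" by simp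
  hence "Z = (Q * R) * transpose_mat V"
    using P Q R V Z QP assoc_mult_mat[OF Q P Z(1)] assoc_mult_mat[OF Q R, of "transpose_mat V" m]
    by simp
  hence "B = U * (Q * R) * transpose_mat V"
    using Z assoc_mult_mat[OF U mult_carrier_mat[OF Q R], of "transpose_mat V" m] V by simp
  thus ?thesis by (rule that[OF mult_carrier_mat[OF Q R]])
qed

section \<open>Both parts of the statement combined\<close>

theorem proposition1:
  fixes A B :: "real mat" and n m r k :: nat
  assumes "A \<in> carrier_mat n m" and "B \<in> carrier_mat n m"
    and "r = mat_rank A"
    and "1 \<le> k" and "k \<le> min n m"
  shows
    "(k > r \<longrightarrow> (compound_mat k A = compound_mat k B \<longleftrightarrow> mat_rank B < k)) \<and>
     (k = r \<longrightarrow>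
       (\<forall>U \<in> carrier_mat n r. \<forall>V \<in> carrier_mat m r.
          rank_revealing_factorization A U V \<longrightarrow>
          (compound_mat k A = compound_mat k B \<longleftrightarrow>
           B \<in> {U * T * transpose_mat V | T. T \<in> carrier_mat r r \<and> det T = 1})))"
proof (intro conjI impI ballI)
  assume "k > r"
  hence "compound_mat k A = compound_mat k (0\<^sub>m n m)"
    using compound_mat_eq_zero_iff[OF assms(1,4,5)] assms(3) by simp
  thus "compound_mat k A = compound_mat k B \<longleftrightarrow> mat_rank B < k"
    using compound_mat_eq_zero_iff[OF assms(2,4,5)] by auto
next
  fix U V assume kr: "k = r" and "U \<in> carrier_mat n r" "V \<in> carrier_mat m r"
    and "rank_revealing_factorization A U V"
  hence U: "U \<in> carrier_mat n k" and V: "V \<in> carrier_mat m k"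
    and "A = U * transpose_mat V"
    by (auto simp: rank_revealing_factorization_def)
  \<comment> \<open>With the identity in the middle, \<open>A\<close> is the case
    \<open>T = 1\<^sub>m k\<close> of \<open>det_select_mult\<close>.\<close>
  hence A: "A = U * 1\<^sub>m k * transpose_mat V" by simp
  note eq_iff = compound_mat_eq_iff_select[OF assms(1,2,5)]
  have minorA: "det (select_mat k A f g) = det (select_mat k U f id) * det (select_mat k V g id)"
    if "\<And>i. i < k \<Longrightarrow> f i < n" "\<And>j. j < k \<Longrightarrow> g j < m" for f g
    unfolding A using that by (subst det_select_mult[OF U _ V]) auto
  show "compound_mat k A = compound_mat k B \<longleftrightarrow>
           B \<in> {U * T * transpose_mat V | T. T \<in> carrier_mat r r \<and> det T = 1}"
  proof
    assume "B \<in> {U * T * transpose_mat V | T. T \<in> carrier_mat r r \<and> det T = 1}"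
    then obtain T where T: "T \<in> carrier_mat k k" "det T = 1" and B: "B = U * T * transpose_mat V"
      using kr by auto
    show "compound_mat k A = compound_mat k B"
      unfolding eq_iff
    proof (intro allI impI)
      fix f g assume *: "\<forall>i<k. f i < n" "\<forall>j<k. g j < m"
      show "det (select_mat k A f g) = det (select_mat k B f g)"
        unfolding B using * by (subst minorA, simp, simp, subst det_select_mult[OF U T(1) V])
          (auto simp: T)
    qed
  next
    assume "compound_mat k A = compound_mat k B"
    hence minorB: "det (select_mat k B f g) = det (select_mat k U f id) * det (select_mat k V g id)"
      if "\<And>i. i < k \<Longrightarrow> f i < n" "\<And>j. j < k \<Longrightarrow> g j < m" for f g
      using minorA that unfolding eq_iff by metis
    \<comment> \<open>Rank \<open>k\<close> yields a nonzero minor of \<open>A\<close>; both of its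
      factors are then nonzero, and by \<open>minorB\<close> so is the same minor of
      \<open>B\<close>.\<close>
    have "\<not> vec_space.rank n A < k" using kr assms(1,3) by simp
    then obtain f g where f: "\<And>i. i < k \<Longrightarrow> f i < n" and g: "\<And>j. j < k \<Longrightarrow> g j < m"
      and "det (select_mat k A f g) \<noteq> 0"
      using vanishing_minors_rank_less[OF assms(1)] by metis
    hence nzU: "det (select_mat k U f id) \<noteq> 0" and nzV: "det (select_mat k V g id) \<noteq> 0"
      using minorA by auto
    have BT: "transpose_mat B \<in> carrier_mat m n" using assms(2) by simp
    have minorBT: "det (select_mat k (transpose_mat B) g f) =
        det (select_mat k V g id) * det (select_mat k U f id)"
      if "\<And>j. j < k \<Longrightarrow> g j < m" "\<And>i. i < k \<Longrightarrow> f i < n" for f g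
      using minorB[OF that(2,1)] transpose_select_mat[OF assms(2), of k f g] that
        det_transpose[OF select_mat_carrier[of k B f g]] by simp
    have k: "0 < k" using assms(4) by simp
    obtain Z where Z: "Z \<in> carrier_mat k m" "B = U * Z"
      by (rule factor_of_factored_minors[OF assms(2) U k minorB f g])
        (use minorB[OF f g] nzU nzV in auto)
    obtain W where W: "W \<in> carrier_mat k n" "transpose_mat B = V * W"
      by (rule factor_of_factored_minors[OF BT V k minorBT g f])
        (use minorBT[OF g f] nzU nzV in auto)
    obtain T where T: "T \<in> carrier_mat k k" "B = U * T * transpose_mat V"
      using factor_through_both[OF assms(2) U V Z W f nzU] by blast
    \<comment> \<open>The same minor of \<open>B\<close> is computed through \<open>T\<close> and
      through \<open>minorB\<close>; cancelling the nonzero factors determines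
      \<open>det T\<close>.\<close>
    have "det (select_mat k U f id) * det T * det (select_mat k V g id) =
        det (select_mat k U f id) * det (select_mat k V g id)"
      using minorB[OF f g] det_select_mult[OF U T(1) V f g] T(2) by simp
    hence "det T = 1" using nzU nzV by simp
    thus "B \<in> {U * T * transpose_mat V | T. T \<in> carrier_mat r r \<and> det T = 1}"
      using T kr by auto
  qed
qed

end
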